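(* Let $\|\cdot\|$ be a norm on $\mathbb{R}^d$, with dual norm $\|\cdot\|_\star$ and unit ball $B=\{x\in\mathbb{R}^d : \|x\|\le 1\}$. The following assertions are equivalent. 1. The norm $\|\cdot\|$ is orthant-monotonic. 2. The dual norm $\|\cdot\|_\star$ is orthant-monotonic. 3. $\|\cdot\|_{K,\star}=\|\cdot\|_{\star,K}$ for all $K\subset\{1,\dots,d\}$. 4. $\mathcal{R}_K$ is Birkhoff orthogonal to $\mathcal{R}_{-K}$ for all $K\subset\{1,\dots,d\}$. 5. $\mathcal{R}_K$ is Birkhoff orthogonal to $\mathcal{R}_{-K}$ for all $K\subset\{1,\dots,d\}$ with $|K|=d-1$. 6. For any vector $u\in\mathbb{R}^d\setminus\{0\}$, there exists a vector $v\in\mathbb{R}^d\setminus\{0\}$ such that $\mathrm{supp}(v)\subset\mathrm{supp}(u)$, $u\circ v\ge 0$, and $\langle u,v\rangle=\|u\|\,\|v\|_\star$. 7. For any $x\in\mathbb{R}^d$ and any $J\subset K\subset\{1,\dots,d\}$, we have $\|x_J\|\le\|x_K\|$. 8. $\pi_K(B)=\mathcal{R}_K\cap B$ for all $K\subset\{1,\dots,d\}$.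
   Context: $d\ge 1$ is an integer and $\mathbb{R}^d$ carries the standard scalar product $\langle\cdot,\cdot\rangle$. The dual norm is $\|y\|_\star=\sup_{\|x\|\le 1}\langle x,y\rangle$. For $x\in\mathbb{R}^d$, $\mathrm{supp}(x)=\{j : x_j\ne 0\}$, $|x|=(|x_1|,\dots,|x_d|)$, and $x\circ x'=(x_1x_1',\dots,x_dx_d')$ is the entrywise product; inequalities between vectors such as $|x|\le|x'|$ and $u\circ v\ge0$ are componentwise. For $K\subset\{1,\dots,d\}$, $|K|$ is its cardinality, $-K=\{1,\dots,d\}\setminus K$, $\mathcal{R}_K=\{x\in\mathbb{R}^d : x_j=0 \ \forall j\notin K\}$ (with $\mathcal{R}_\emptyset=\{0\}$), $\pi_K:\mathbb{R}^d\to\mathcal{R}_K$ is the orthogonal projection, and $x_K=\pi_K(x)$ (the vector that coincides with $x$ on $K$ and is zero outside $K$). On $\mathcal{R}_K$: $\|\cdot\|_K$ is the restriction of $\|\cdot\|$ to $\mathcal{R}_K$; $\|\cdot\|_{\star,K}$ is the restriction of the dual norm $\|\cdot\|_\star$ to $\mathcal{R}_K$; $\|\cdot\|_{K,\star}$ is the dual norm, on the subspace $\mathcal{R}_K$, of $\|\cdot\|_K$, i.e. $\|y\|_{K,\star}=\sup\{\langle x,y\rangle : x\in\mathcal{R}_K,\ \|x\|\le 1\}$ for $y\in\mathcal{R}_K$. A norm $\|\cdot\|$ is orthant-monotonic if, for all $x,x'\in\mathbb{R}^d$, ($|x|\le|x'|$ and $x\circ x'\ge 0$) implies $\|x\|\le\|x'\|$.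 For subspaces $U,V$ of $\mathbb{R}^d$, $U$ is Birkhoff orthogonal to $V$ (for $\|\cdot\|$) if $\|u+v\|\ge\|u\|$ for all $u\in U$, $v\in V$. *)

theory Defs
  imports "HOL-Analysis.Analysis"
begin

text \<open>
  The space \<open>\<real>\<^sup>d\<close> is \<^typ>\<open>real ^ 'd\<close>, whose dimension \<open>CARD('d)\<close> is arbitrary and at least 1;
  subsets of \<open>{1,\<dots>,d}\<close> are sets of type \<^typ>\<open>'d set\<close>. The order \<open>\<le>\<close>, the absolute
  value and the product \<open>*\<close> of the library on this type are all componentwise. The norm under study
  is an arbitrary function satisfying the norm axioms, as the library's \<open>norm\<close> is the Euclidean one.
\<close>

definition is_norm :: "('a::real_vector \<Rightarrow> real) \<Rightarrow> bool" where
  "is_norm N \<longleftrightarrow>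
     (\<forall>x. 0 \<le> N x) \<and>
     (\<forall>x. N x = 0 \<longleftrightarrow> x = 0) \<and>
     (\<forall>c x. N (c *\<^sub>R x) = \<bar>c\<bar> * N x) \<and>
     (\<forall>x y. N (x + y) \<le> N x + N y)"

definition unit_ball :: "('a::real_vector \<Rightarrow> real) \<Rightarrow> 'a set" where
  "unit_ball N = {x. N x \<le> 1}"

text \<open>
  For a subspace \<open>S\<close> and \<open>y \<in> S\<close>, the dual norm at \<open>y\<close> of the restriction of \<open>N\<close> to \<open>S\<close>.
  When \<open>N\<close> is a norm on a Euclidean space, the supremum is over a nonempty set bounded above.
\<close>

definition dual_norm_on :: "'a::real_inner set \<Rightarrow> ('a \<Rightarrow> real) \<Rightarrow> 'a \<Rightarrow> real" where
  "dual_norm_on S N y = (SUP x\<in>{x \<in> S. N x \<le> 1}. x \<bullet> y)"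

definition dual_norm :: "('a::real_inner \<Rightarrow> real) \<Rightarrow> 'a \<Rightarrow> real" where
  "dual_norm N y = (SUP x\<in>{x. N x \<le> 1}. x \<bullet> y)"

definition supp :: "real ^ 'd \<Rightarrow> 'd set" where
  "supp x = {j. x $ j \<noteq> 0}"

definition coord_subspace :: "'d set \<Rightarrow> (real ^ 'd) set" where
  "coord_subspace K = {x. \<forall>j. j \<notin> K \<longrightarrow> x $ j = 0}"

definition coord_proj :: "'d set \<Rightarrow> real ^ 'd \<Rightarrow> real ^ 'd" where
  "coord_proj K x = (\<chi> j. if j \<in> K then x $ j else 0)"

definition orthant_monotonic :: "(real ^ 'd \<Rightarrow> real) \<Rightarrow> bool" where
  "orthant_monotonic N \<longleftrightarrow>
     (\<forall>x x'. \<bar>x\<bar> \<le> \<bar>x'\<bar> \<and> 0 \<le> x * x' \<longrightarrow> N x \<le> N x')"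

definition birkhoff_orthogonal ::
  "('a::real_vector \<Rightarrow> real) \<Rightarrow> 'a set \<Rightarrow> 'a set \<Rightarrow> bool" where
  "birkhoff_orthogonal N U V \<longleftrightarrow> (\<forall>u\<in>U. \<forall>v\<in>V. N (u + v) \<ge> N u)"

lemma subspace_coord_subspace: "subspace (coord_subspace K)"
  by (auto simp: subspace_def coord_subspace_def)

text \<open>The map \<^const>\<open>coord_proj\<close> is the orthogonal projection onto \<^const>\<open>coord_subspace\<close>.\<close>

lemma coord_proj_in: "coord_proj K x \<in> coord_subspace K"
  by (simp add: coord_subspace_def coord_proj_def)

lemma coord_proj_orthogonal:
  assumes "y \<in> coord_subspace K"
  shows "orthogonal (x - coord_proj K x) y"
  using assms
  by (auto simp: orthogonal_def inner_vec_def coord_subspace_def coord_proj_def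
      intro!: sum.neutral)

lemma abs_le_times_nonneg_vec_iff:
  fixes x x' :: "real ^ 'd"
  shows "\<bar>x\<bar> \<le> \<bar>x'\<bar> \<longleftrightarrow> (\<forall>j. \<bar>x $ j\<bar> \<le> \<bar>x' $ j\<bar>)"
    and "0 \<le> x * x' \<longleftrightarrow> (\<forall>j. 0 \<le> x $ j * x' $ j)"
  by (simp_all add: less_eq_vec_def abs_vec_def times_vec_def)

end

theory Submission
  imports Defs
begin

text \<open>
  Orthant-monotonicity says that the norm decreases when coordinates are shrunk towards zero without
  changing sign. All the assertions say the same thing: every coordinate projection is a contraction,
  \<open>N (coord_proj K x) \<le> N x\<close>. A projection shrinks coordinates, so it contracts an orthant-monotonic
  norm. Conversely, shrinking one coordinate by a factor \<open>t \<in> [0,1]\<close> produces the convex combination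
  of \<open>x\<close> and of its projection deleting that coordinate, so contractivity of the projections that
  delete a single coordinate is already enough: one shrinks the coordinates one after the other
  (\<open>orthant_monotonicI\<close>). Birkhoff orthogonality, the comparison of \<open>x\<^sub>J\<close> with \<open>x\<^sub>K\<close>, and the equality
  of the projection and the section of the unit ball are direct rewordings of contractivity.

  The remaining assertions involve the dual norm, and rest on duality in finite dimension: each \<open>u\<close>
  has a norming functional \<open>y\<close>, with \<open>N\<^sub>\<star> y \<le> 1\<close> and \<open>u \<bullet> y = N u\<close> (\<open>norming_functional\<close>), which yields
  in particular \<open>N\<^sub>\<star>\<^sub>\<star> = N\<close>. Coordinate projections are self-adjoint, hence contract \<open>N\<close> if and only if
  they contract \<open>N\<^sub>\<star>\<close>. For a vector \<open>u\<close> supported in \<open>K\<close>, a vector \<open>v\<close> supported in \<open>K\<close> that attains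
  \<open>u \<bullet> v = N u * N\<^sub>\<star> v\<close> certifies contractivity at \<open>u\<close>, as \<open>u \<bullet> v\<close> does not see the
  coordinates outside \<open>K\<close>; such a \<open>v\<close> is obtained by projecting a norming functional of \<open>u\<close>.
\<close>

section \<open>Norms and dual norms on Euclidean spaces\<close>

lemma is_normD:
  assumes "is_norm N"
  shows "0 \<le> N x" and "N x = 0 \<longleftrightarrow> x = 0" and "N (c *\<^sub>R x) = \<bar>c\<bar> * N x"
    and "N (x + y) \<le> N x + N y"
  using assms by (auto simp: is_norm_def)

lemma is_norm_pos:
  assumes "is_norm N" "x \<noteq> 0"
  shows "0 < N x"
  using is_normD[OF assms(1)] assms(2) by (metis less_eq_real_def)

lemma is_norm_zero [simp]: "is_norm N \<Longrightarrow> N 0 = 0"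
  using is_normD(2) by blast

lemma is_norm_minus: "is_norm N \<Longrightarrow> N (- x) = N x"
  using is_normD(3)[of N "- 1" x] by simp

lemma is_norm_convex_on:
  assumes N: "is_norm N"
  shows "convex_on UNIV N"
proof (rule convex_onI)
  fix t :: real and x y
  assume "0 < t" "t < 1"
  then show "N ((1 - t) *\<^sub>R x + t *\<^sub>R y) \<le> (1 - t) * N x + t * N y"
    using is_normD(4)[OF N, of "(1 - t) *\<^sub>R x" "t *\<^sub>R y"] by (simp add: is_normD(3)[OF N])
qed simp

text \<open>
  The minimum of the continuous function \<open>N\<close> on the Euclidean unit sphere is positive; by homogeneity,
  the Euclidean norm is thus dominated by a multiple of \<open>N\<close>.
\<close>

lemma is_norm_dominates_norm:
  fixes N :: "'a::euclidean_space \<Rightarrow> real"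
  assumes N: "is_norm N"
  obtains C where "0 < C" "\<And>x. norm x \<le> C * N x"
proof -
  have "continuous_on UNIV N"
    by (rule convex_on_continuous) (auto simp: is_norm_convex_on N)
  then have "continuous_on (sphere 0 1) N"
    using continuous_on_subset by blast
  then obtain z where z: "z \<in> sphere 0 1" "\<And>x. x \<in> sphere 0 1 \<Longrightarrow> N z \<le> N x"
    using continuous_attains_inf[of "sphere (0::'a) 1" N] by auto
  have pos: "0 < N z"
    using z(1) by (intro is_norm_pos[OF N]) auto
  show ?thesis
  proof (rule that)
    show "0 < 1 / N z"
      using pos by simp
    show "norm x \<le> 1 / N z * N x" for x
    proof (cases "x = 0")
      case False
      then have "N z \<le> N ((1 / norm x) *\<^sub>R x)"
        by (intro z(2)) simp
      also have "\<dots> = N x / norm x"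
        by (simp add: is_normD(3)[OF N])
      finally show ?thesis
        using False pos by (simp add: field_simps)
    qed (simp add: N)
  qed
qed

lemma bdd_above_inner_unit_ball:
  fixes N :: "'a::euclidean_space \<Rightarrow> real"
  assumes N: "is_norm N"
  shows "bdd_above ((\<lambda>x. x \<bullet> y) ` {x \<in> S. N x \<le> 1})"
proof -
  obtain C where C: "0 < C" "\<And>x. norm x \<le> C * N x"
    using is_norm_dominates_norm[OF N] by blast
  have "x \<bullet> y \<le> C * norm y" if "N x \<le> 1" for x
  proof -
    have "norm x \<le> C"
      using C(2)[of x] mult_left_le[OF that, of C] C(1) by linarith
    then have "norm x * norm y \<le> C * norm y"
      by (intro mult_right_mono) auto
    then show ?thesis
      using norm_cauchy_schwarz[of x y] by linarith
  qed
  then show ?thesis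
    by (auto intro!: bdd_aboveI)
qed

lemma dual_norm_eq_on_UNIV: "dual_norm N = dual_norm_on UNIV N"
  by (rule ext) (simp add: dual_norm_def dual_norm_on_def)

lemma dual_norm_on_upper:
  fixes N :: "'a::euclidean_space \<Rightarrow> real"
  assumes "is_norm N" "x \<in> S" "N x \<le> 1"
  shows "x \<bullet> y \<le> dual_norm_on S N y"
  unfolding dual_norm_on_def using assms
  by (intro cSUP_upper bdd_above_inner_unit_ball) auto

lemma dual_norm_on_least:
  assumes "is_norm N" "subspace S" "\<And>x. x \<in> S \<Longrightarrow> N x \<le> 1 \<Longrightarrow> x \<bullet> y \<le> c"
  shows "dual_norm_on S N y \<le> c"
  unfolding dual_norm_on_def using assms
  by (intro cSUP_least) (auto intro!: exI[of _ 0] simp: subspace_0)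

lemmas dual_norm_upper = dual_norm_on_upper[of _ _ UNIV, folded dual_norm_eq_on_UNIV, simplified]
lemmas dual_norm_least = dual_norm_on_least[of _ UNIV, folded dual_norm_eq_on_UNIV, simplified]

lemma inner_le_dual_norm:
  fixes N :: "'a::euclidean_space \<Rightarrow> real"
  assumes N: "is_norm N"
  shows "x \<bullet> y \<le> N x * dual_norm N y"
proof (cases "x = 0")
  case False
  then have pos: "0 < N x"
    by (rule is_norm_pos[OF N])
  have "((1 / N x) *\<^sub>R x) \<bullet> y \<le> dual_norm N y"
    using pos by (intro dual_norm_upper[OF N]) (simp add: is_normD(3)[OF N])
  then show ?thesis
    using pos by (simp add: field_simps)
qed (simp add: N)

lemma is_norm_dual_norm:
  fixes N :: "'a::euclidean_space \<Rightarrow> real"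
  assumes N: "is_norm N"
  shows "is_norm (dual_norm N)"
proof -
  have nonneg: "0 \<le> dual_norm N y" for y
    using dual_norm_upper[OF N, of 0 y] N by simp
  have zero: "dual_norm N 0 = 0"
    using dual_norm_least[OF N, of 0 0] nonneg[of 0] by simp
  have definite: "y = 0" if "dual_norm N y = 0" for y
  proof -
    have "y \<bullet> y \<le> 0"
      using inner_le_dual_norm[OF N, of y y] that by simp
    then show ?thesis
      by (metis inner_gt_zero_iff not_le)
  qed
  have scale_le: "dual_norm N (c *\<^sub>R y) \<le> \<bar>c\<bar> * dual_norm N y" for c y
  proof (rule dual_norm_least[OF N])
    fix x assume "N x \<le> 1"
    then have "\<bar>x \<bullet> y\<bar> \<le> dual_norm N y"
      using dual_norm_upper[OF N, of x y] dual_norm_upper[OF N, of "- x" y] is_norm_minus[OF N, of x]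
      by simp
    then have "\<bar>c\<bar> * \<bar>x \<bullet> y\<bar> \<le> \<bar>c\<bar> * dual_norm N y"
      by (simp add: mult_left_mono)
    then show "x \<bullet> (c *\<^sub>R y) \<le> \<bar>c\<bar> * dual_norm N y"
      by (simp flip: abs_mult)
  qed
  have scale: "dual_norm N (c *\<^sub>R y) = \<bar>c\<bar> * dual_norm N y" for c y
  proof (cases "c = 0")
    case False
    then show ?thesis
      using scale_le[of c y] scale_le[of "1 / c" "c *\<^sub>R y"] by (simp add: field_simps)
  qed (simp add: zero)
  have triangle: "dual_norm N (y + z) \<le> dual_norm N y + dual_norm N z" for y z
    by (rule dual_norm_least[OF N]) (auto simp: inner_add_right intro!: add_mono dual_norm_upper[OF N])
  show ?thesis
    using nonneg zero definite scale triangle by (auto simp: is_norm_def)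
qed

text \<open>
  The normalized vector \<open>u / N u\<close> lies outside the open unit ball of \<open>N\<close>. A hyperplane separating it
  from that ball supports the closed unit ball there, and its normal vector, suitably scaled,
  is the functional.
\<close>

lemma norming_functional:
  fixes N :: "'a::euclidean_space \<Rightarrow> real"
  assumes N: "is_norm N"
  obtains y where "dual_norm N y \<le> 1" "u \<bullet> y = N u"
proof (cases "u = 0")
  case True
  have "dual_norm N 0 \<le> 1"
    by (rule dual_norm_least[OF N]) simp
  then show ?thesis
    using True N by (intro that[of 0]) auto
next
  case False
  then have pos: "0 < N u"
    by (rule is_norm_pos[OF N])
  define w where "w = (1 / N u) *\<^sub>R u"
  have Nw: "N w = 1"
    using pos by (simp add: w_def is_normD(3)[OF N])
  have "convex {x. N x < 1}"
  proof (rule convexI, unfold mem_Collect_eq)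
    fix x y and a b :: real
    assume "N x < 1" "N y < 1" "0 \<le> a" "0 \<le> b" "a + b = 1"
    then have "a * N x + b * N y < 1"
      by (rule convex_bound_lt)
    then show "N (a *\<^sub>R x + b *\<^sub>R y) < 1"
      using is_normD(4)[OF N, of "a *\<^sub>R x" "b *\<^sub>R y"] \<open>0 \<le> a\<close> \<open>0 \<le> b\<close>
      by (simp add: is_normD(3)[OF N])
  qed
  moreover have "0 \<in> {x. N x < 1}" and "{x. N x < 1} \<inter> {w} = {}"
    using Nw N by auto
  ultimately obtain a b
    where a: "a \<noteq> 0" "\<And>x. N x < 1 \<Longrightarrow> a \<bullet> x \<le> b" "b \<le> a \<bullet> w"
    using separating_hyperplane_sets[of "{x. N x < 1}" "{w}"] by auto
  have closed_ball: "a \<bullet> x \<le> a \<bullet> w" if "N x \<le> 1" for x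
  proof (rule field_le_mult_one_interval)
    fix t :: real assume t: "0 < t" "t < 1"
    then have "t * N x < 1"
      using mult_left_le[OF that, of t] by linarith
    then have "N (t *\<^sub>R x) < 1"
      using t by (simp add: is_normD(3)[OF N])
    then show "t * (a \<bullet> x) \<le> a \<bullet> w"
      using a(2)[of "t *\<^sub>R x"] a(3) by simp
  qed
  have "0 < (a \<bullet> a) / N a"
    using a(1) is_norm_pos[OF N] by simp
  also have "\<dots> \<le> a \<bullet> w"
    using closed_ball[of "(1 / N a) *\<^sub>R a"] is_norm_pos[OF N a(1)] by (simp add: is_normD(3)[OF N])
  finally have aw: "0 < a \<bullet> w" .
  show ?thesis
  proof (rule that)
    show "dual_norm N ((1 / (a \<bullet> w)) *\<^sub>R a) \<le> 1"
      using aw closed_ball by (intro dual_norm_least[OF N]) (simp add: inner_commute)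
    have "a \<bullet> u = N u * (a \<bullet> w)"
      using pos by (simp add: w_def)
    then show "u \<bullet> ((1 / (a \<bullet> w)) *\<^sub>R a) = N u"
      using aw by (simp add: inner_commute)
  qed
qed

lemma dual_norm_dual_norm:
  fixes N :: "'a::euclidean_space \<Rightarrow> real"
  assumes N: "is_norm N"
  shows "dual_norm (dual_norm N) = N"
proof (rule ext, rule antisym)
  fix x
  show "dual_norm (dual_norm N) x \<le> N x"
  proof (rule dual_norm_least[OF is_norm_dual_norm[OF N]])
    fix y assume "dual_norm N y \<le> 1"
    then have "N x * dual_norm N y \<le> N x"
      by (intro mult_left_le is_normD(1)[OF N])
    then show "y \<bullet> x \<le> N x"
      using inner_le_dual_norm[OF N, of x y] by (simp add: inner_commute)
  qed
  obtain y where "dual_norm N y \<le> 1" "x \<bullet> y = N x"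
    using norming_functional[OF N] .
  then show "N x \<le> dual_norm (dual_norm N) x"
    using dual_norm_upper[OF is_norm_dual_norm[OF N], of y x] by (simp add: inner_commute)
qed

section \<open>Coordinate projections\<close>

lemma coord_proj_id: "x \<in> coord_subspace K \<Longrightarrow> coord_proj K x = x"
  by (auto simp: coord_subspace_def coord_proj_def vec_eq_iff)

lemma coord_proj_compl_in: "x - coord_proj K x \<in> coord_subspace (- K)"
  by (auto simp: coord_subspace_def coord_proj_def)

lemma coord_proj_add:
  "u \<in> coord_subspace K \<Longrightarrow> v \<in> coord_subspace (- K) \<Longrightarrow> coord_proj K (u + v) = u"
  by (auto simp: coord_subspace_def coord_proj_def vec_eq_iff)

lemma coord_proj_scaleR: "coord_proj K (c *\<^sub>R x) = c *\<^sub>R coord_proj K x"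
  by (auto simp: coord_proj_def vec_eq_iff)

lemma coord_proj_UNIV: "coord_proj UNIV x = x"
  by (simp add: coord_proj_def vec_lambda_eta)

lemma coord_proj_self_adjoint: "coord_proj K x \<bullet> y = x \<bullet> coord_proj K y"
  by (auto simp: inner_vec_def coord_proj_def intro!: sum.cong)

lemma inner_coord_subspace:
  assumes "y \<in> coord_subspace K"
  shows "x \<bullet> y = coord_proj K x \<bullet> y"
  by (simp add: coord_proj_self_adjoint coord_proj_id[OF assms])

section \<open>Orthant-monotonicity as contractivity of the coordinate projections\<close>

text \<open>
  The vector \<open>x\<close> is obtained from \<open>x'\<close> by multiplying each coordinate by a factor in \<open>[0,1]\<close>. It suffices
  to treat the coordinates one at a time, and then convexity of the norm on the segment from
  the vector to its projection applies.
\<close>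

lemma orthant_monotonicI:
  fixes N :: "real ^ 'd \<Rightarrow> real"
  assumes N: "is_norm N"
    and contr: "\<And>j x. N (coord_proj (- {j}) x) \<le> N x"
  shows "orthant_monotonic N"
  unfolding orthant_monotonic_def
proof (intro allI impI)
  fix x x' :: "real ^ 'd"
  assume "\<bar>x\<bar> \<le> \<bar>x'\<bar> \<and> 0 \<le> x * x'"
  then have xx': "\<And>j. \<bar>x $ j\<bar> \<le> \<bar>x' $ j\<bar>" "\<And>j. 0 \<le> x $ j * x' $ j"
    by (simp_all add: abs_le_times_nonneg_vec_iff)
  have scale_coordinate: "N (\<chi> i. if i = j then t * z $ i else z $ i) \<le> N z"
    if t: "0 \<le> t" "t \<le> 1" for j t z
  proof -
    have "(\<chi> i. if i = j then t * z $ i else z $ i) = t *\<^sub>R z + (1 - t) *\<^sub>R coord_proj (- {j}) z"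
      by (auto simp: vec_eq_iff coord_proj_def algebra_simps)
    then have "N (\<chi> i. if i = j then t * z $ i else z $ i)
        \<le> t * N z + (1 - t) * N (coord_proj (- {j}) z)"
      using is_normD(4)[OF N, of "t *\<^sub>R z" "(1 - t) *\<^sub>R coord_proj (- {j}) z"] t
      by (simp add: is_normD(3)[OF N])
    also have "\<dots> \<le> t * N z + (1 - t) * N z"
      using t contr by (intro add_left_mono mult_left_mono) auto
    finally show ?thesis
      by (simp add: algebra_simps)
  qed
  (* Where x' vanishes, so does x, and the factor 0 / 0 = 0 is correct. *)
  define t where "t j = x $ j / x' $ j" for j
  have t: "0 \<le> t j" "t j \<le> 1" "t j * x' $ j = x $ j" for j
    using xx'[of j] by (auto simp: t_def divide_simps abs_if zero_le_mult_iff split: if_splits)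
  have "N (\<chi> i. if i \<in> A then t i * x' $ i else x' $ i) \<le> N x'" for A
  proof (induction A rule: finite_induct[OF finite])
    case 1
    then show ?case
      by (simp add: vec_lambda_eta)
  next
    case (2 j A)
    let ?z = "\<chi> i. if i \<in> A then t i * x' $ i else x' $ i"
    have "(\<chi> i. if i \<in> insert j A then t i * x' $ i else x' $ i)
        = (\<chi> i. if i = j then t j * ?z $ i else ?z $ i)"
      using 2 by (auto simp: vec_eq_iff)
    then show ?case
      using scale_coordinate[of "t j" j ?z] t[of j] 2 by simp
  qed
  from this[of UNIV] show "N x \<le> N x'"
    by (simp add: t vec_lambda_eta)
qed

lemma orthant_monotonic_coord_proj_mono:
  assumes "orthant_monotonic N" "J \<subseteq> K"
  shows "N (coord_proj J x) \<le> N (coord_proj K x)"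
proof -
  have "\<bar>coord_proj J x\<bar> \<le> \<bar>coord_proj K x\<bar> \<and> 0 \<le> coord_proj J x * coord_proj K x"
    using assms(2) by (auto simp: abs_le_times_nonneg_vec_iff coord_proj_def)
  then show ?thesis
    using assms(1) unfolding orthant_monotonic_def by blast
qed

lemma orthant_monotonic_iff_coord_proj_contractive:
  fixes N :: "real ^ 'd \<Rightarrow> real"
  assumes "is_norm N"
  shows "orthant_monotonic N \<longleftrightarrow> (\<forall>K x. N (coord_proj K x) \<le> N x)"
  using orthant_monotonicI[OF assms] orthant_monotonic_coord_proj_mono[of N _ UNIV]
  by (auto simp: coord_proj_UNIV)

lemma birkhoff_orthogonal_coord_iff:
  "birkhoff_orthogonal N (coord_subspace K) (coord_subspace (- K))
     \<longleftrightarrow> (\<forall>x. N (coord_proj K x) \<le> N x)"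
proof
  assume B: "birkhoff_orthogonal N (coord_subspace K) (coord_subspace (- K))"
  show "\<forall>x. N (coord_proj K x) \<le> N x"
  proof
    fix x
    have "N (coord_proj K x) \<le> N (coord_proj K x + (x - coord_proj K x))"
      using B coord_proj_in coord_proj_compl_in unfolding birkhoff_orthogonal_def by blast
    then show "N (coord_proj K x) \<le> N x"
      by simp
  qed
next
  assume "\<forall>x. N (coord_proj K x) \<le> N x"
  then show "birkhoff_orthogonal N (coord_subspace K) (coord_subspace (- K))"
    unfolding birkhoff_orthogonal_def by (metis coord_proj_add)
qed

lemma card_eq_CARD_minus_1_iff:
  fixes K :: "'d::finite set"
  shows "card K = CARD('d) - 1 \<longleftrightarrow> (\<exists>j. K = - {j})"
proof
  assume "card K = CARD('d) - 1"
  moreover have "card K + card (- K) = CARD('d)"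
    by (metis card_Un_disjoint Compl_disjoint Compl_partition finite)
  moreover have "0 < CARD('d)"
    by simp
  ultimately have "card (- K) = 1"
    by linarith
  then show "\<exists>j. K = - {j}"
    by (metis card_1_singletonE double_complement)
qed (auto simp: Compl_eq_Diff_UNIV card_Diff_singleton)

text \<open>
  The projection of the ball always contains its section. By homogeneity, the reverse inclusion
  compares the norms of all vectors with those of their projections.
\<close>

lemma coord_proj_unit_ball_iff:
  fixes N :: "real ^ 'd \<Rightarrow> real"
  assumes N: "is_norm N"
  shows "coord_proj K ` unit_ball N = coord_subspace K \<inter> unit_ball N
     \<longleftrightarrow> (\<forall>x. N (coord_proj K x) \<le> N x)"
proof
  assume eq: "coord_proj K ` unit_ball N = coord_subspace K \<inter> unit_ball N"
  show "\<forall>x. N (coord_proj K x) \<le> N x"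
  proof
    fix x
    show "N (coord_proj K x) \<le> N x"
    proof (cases "x = 0")
      case True
      then show ?thesis
        using coord_proj_scaleR[of K 0 x] by simp
    next
      case False
      then have pos: "0 < N x"
        by (rule is_norm_pos[OF N])
      then have "(1 / N x) *\<^sub>R x \<in> unit_ball N"
        by (simp add: unit_ball_def is_normD(3)[OF N])
      then have "N (coord_proj K ((1 / N x) *\<^sub>R x)) \<le> 1"
        using eq by (auto simp: unit_ball_def)
      then show ?thesis
        using pos by (simp add: coord_proj_scaleR is_normD(3)[OF N])
    qed
  qed
next
  assume contr: "\<forall>x. N (coord_proj K x) \<le> N x"
  have "coord_subspace K \<inter> unit_ball N \<subseteq> coord_proj K ` unit_ball N"
    by (metis IntE coord_proj_id image_eqI subsetI)
  moreover have "coord_proj K ` unit_ball N \<subseteq> coord_subspace K \<inter> unit_ball N"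
    using contr by (auto simp: unit_ball_def coord_proj_in intro: order_trans)
  ultimately show "coord_proj K ` unit_ball N = coord_subspace K \<inter> unit_ball N"
    by blast
qed

section \<open>Orthant-monotonicity and duality\<close>

text \<open>A self-adjoint contraction for \<open>N\<close> is a contraction for the dual norm.\<close>

lemma dual_norm_coord_proj_le:
  fixes N :: "real ^ 'd \<Rightarrow> real"
  assumes N: "is_norm N" and contr: "\<And>x. N (coord_proj K x) \<le> N x"
  shows "dual_norm N (coord_proj K y) \<le> dual_norm N y"
proof (rule dual_norm_least[OF N])
  fix x assume "N x \<le> 1"
  then have "coord_proj K x \<bullet> y \<le> dual_norm N y"
    using contr[of x] by (intro dual_norm_upper[OF N]) linarith
  then show "x \<bullet> coord_proj K y \<le> dual_norm N y"
    by (simp add: coord_proj_self_adjoint)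
qed

lemma orthant_monotonic_dual_norm:
  fixes N :: "real ^ 'd \<Rightarrow> real"
  assumes "is_norm N" "orthant_monotonic N"
  shows "orthant_monotonic (dual_norm N)"
  using assms dual_norm_coord_proj_le[OF assms(1)] is_norm_dual_norm[OF assms(1)]
  by (simp add: orthant_monotonic_iff_coord_proj_contractive)

lemma orthant_monotonic_dual_norm_iff:
  fixes N :: "real ^ 'd \<Rightarrow> real"
  assumes "is_norm N"
  shows "orthant_monotonic (dual_norm N) \<longleftrightarrow> orthant_monotonic N"
  using orthant_monotonic_dual_norm[OF assms] dual_norm_dual_norm[OF assms]
    orthant_monotonic_dual_norm[OF is_norm_dual_norm[OF assms]] by auto

text \<open>
  On the subspace, the dual norm of the restriction never exceeds the restriction of the dual norm.
  If \<open>coord_proj K\<close> is contractive, the supremum defining the latter may be restricted to the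
  subspace. Conversely, projecting a norming functional of \<open>u = coord_proj K x\<close> gives \<open>y\<close> in the
  subspace with \<open>N u = u \<bullet> y = x \<bullet> y\<close>, and \<open>y\<close> has dual norm at most 1 on the subspace, hence on the
  whole space.
\<close>

lemma dual_norm_on_coord_subspace_iff:
  fixes N :: "real ^ 'd \<Rightarrow> real"
  assumes N: "is_norm N"
  shows "(\<forall>y\<in>coord_subspace K. dual_norm_on (coord_subspace K) N y = dual_norm N y)
     \<longleftrightarrow> (\<forall>x. N (coord_proj K x) \<le> N x)"
proof
  assume eq: "\<forall>y\<in>coord_subspace K. dual_norm_on (coord_subspace K) N y = dual_norm N y"
  show "\<forall>x. N (coord_proj K x) \<le> N x"
  proof
    fix x
    obtain y' where y': "dual_norm N y' \<le> 1" "coord_proj K x \<bullet> y' = N (coord_proj K x)"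
      using norming_functional[OF N] .
    define y where "y = coord_proj K y'"
    have y_in: "y \<in> coord_subspace K"
      by (simp add: y_def coord_proj_in)
    have "dual_norm_on (coord_subspace K) N y \<le> 1"
    proof (rule dual_norm_on_least[OF N subspace_coord_subspace])
      fix z assume z: "z \<in> coord_subspace K" "N z \<le> 1"
      have "z \<bullet> y = z \<bullet> y'"
        by (simp add: y_def coord_proj_id[OF z(1)] flip: coord_proj_self_adjoint)
      also have "\<dots> \<le> 1"
        using dual_norm_upper[OF N z(2)] y'(1) by (rule order_trans)
      finally show "z \<bullet> y \<le> 1" .
    qed
    then have "dual_norm N y \<le> 1"
      using eq y_in by simp
    have "N (coord_proj K x) = x \<bullet> y"
      using y'(2) by (simp add: y_def coord_proj_self_adjoint)
    also have "\<dots> \<le> N x * dual_norm N y"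
      by (rule inner_le_dual_norm[OF N])
    also have "\<dots> \<le> N x"
      using \<open>dual_norm N y \<le> 1\<close> by (intro mult_left_le is_normD(1)[OF N])
    finally show "N (coord_proj K x) \<le> N x" .
  qed
next
  assume contr: "\<forall>x. N (coord_proj K x) \<le> N x"
  show "\<forall>y\<in>coord_subspace K. dual_norm_on (coord_subspace K) N y = dual_norm N y"
  proof (intro ballI antisym)
    fix y :: "real ^ 'd" assume y: "y \<in> coord_subspace K"
    show "dual_norm_on (coord_subspace K) N y \<le> dual_norm N y"
      by (rule dual_norm_on_least[OF N subspace_coord_subspace]) (rule dual_norm_upper[OF N])
    show "dual_norm N y \<le> dual_norm_on (coord_subspace K) N y"
    proof (rule dual_norm_least[OF N])
      fix x assume "N x \<le> 1"
      then have "N (coord_proj K x) \<le> 1"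
        using contr order_trans by blast
      then show "x \<bullet> y \<le> dual_norm_on (coord_subspace K) N y"
        unfolding inner_coord_subspace[OF y, of x]
        by (intro dual_norm_on_upper[OF N] coord_proj_in)
    qed
  qed
qed

text \<open>
  Keep only the coordinates of a norming functional whose sign agrees with that of \<open>u\<close>. Deleting
  the others does not decrease the scalar product with \<open>u\<close> and, by orthant-monotonicity of the dual
  norm, does not increase the dual norm.
\<close>

lemma orthant_monotonic_dual_vector:
  fixes N :: "real ^ 'd \<Rightarrow> real"
  assumes N: "is_norm N" and om: "orthant_monotonic N" and "u \<noteq> 0"
  obtains v where "v \<noteq> 0" "supp v \<subseteq> supp u" "0 \<le> u * v" "u \<bullet> v = N u * dual_norm N v"
proof -
  obtain y where y: "dual_norm N y \<le> 1" "u \<bullet> y = N u"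
    using norming_functional[OF N] .
  define v where "v = coord_proj {j. 0 < u $ j * y $ j} y"
  have "N u \<le> u \<bullet> v"
    unfolding y(2)[symmetric]
    by (auto simp: v_def inner_vec_def coord_proj_def intro!: sum_mono)
  have "dual_norm N v \<le> 1"
    using dual_norm_coord_proj_le[OF N, of _ y] om y(1)
    unfolding v_def orthant_monotonic_iff_coord_proj_contractive[OF N] by (meson order_trans)
  then have "N u * dual_norm N v \<le> N u"
    by (intro mult_left_le is_normD(1)[OF N])
  then have "u \<bullet> v = N u * dual_norm N v"
    using inner_le_dual_norm[OF N, of u v] \<open>N u \<le> u \<bullet> v\<close> by linarith
  moreover have "v \<noteq> 0"
    using \<open>N u \<le> u \<bullet> v\<close> is_norm_pos[OF N \<open>u \<noteq> 0\<close>] by auto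
  moreover have "supp v \<subseteq> supp u"
    by (auto simp: v_def supp_def coord_proj_def)
  moreover have "0 \<le> u * v"
    by (auto simp: v_def less_eq_vec_def times_vec_def coord_proj_def)
  ultimately show ?thesis
    using that by blast
qed

lemma coord_proj_contractive_if_dual_vector:
  fixes N :: "real ^ 'd \<Rightarrow> real"
  assumes N: "is_norm N"
    and dual: "\<And>u. u \<noteq> 0 \<Longrightarrow> \<exists>v. v \<noteq> 0 \<and> supp v \<subseteq> supp u \<and> u \<bullet> v = N u * dual_norm N v"
  shows "N (coord_proj K x) \<le> N x"
proof (cases "coord_proj K x = 0")
  case True
  then show ?thesis
    by (simp add: N is_normD(1))
next
  case False
  then obtain v where v: "v \<noteq> 0" "supp v \<subseteq> supp (coord_proj K x)"
      "coord_proj K x \<bullet> v = N (coord_proj K x) * dual_norm N v"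
    using dual by blast
  have "v \<in> coord_subspace K"
    using v(2) by (auto simp: supp_def coord_subspace_def coord_proj_def)
  then have "N (coord_proj K x) * dual_norm N v = x \<bullet> v"
    using v(3) inner_coord_subspace by metis
  also have "\<dots> \<le> N x * dual_norm N v"
    by (rule inner_le_dual_norm[OF N])
  finally show ?thesis
    using is_norm_pos[OF is_norm_dual_norm[OF N] v(1)] by simp
qed

theorem proposition4:
  fixes N :: "real ^ 'd \<Rightarrow> real"
  assumes "is_norm N"
  shows
    "(orthant_monotonic N \<longleftrightarrow>
        orthant_monotonic (dual_norm N))
   \<and> (orthant_monotonic N \<longleftrightarrow>
        (\<forall>K. \<forall>y\<in>coord_subspace K. dual_norm_on (coord_subspace K) N y = dual_norm N y))
   \<and> (orthant_monotonic N \<longleftrightarrow>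
        (\<forall>K. birkhoff_orthogonal N (coord_subspace K) (coord_subspace (- K))))
   \<and> (orthant_monotonic N \<longleftrightarrow>
        (\<forall>K. card K = CARD('d) - 1 \<longrightarrow>
          birkhoff_orthogonal N (coord_subspace K) (coord_subspace (- K))))
   \<and> (orthant_monotonic N \<longleftrightarrow>
        (\<forall>u. u \<noteq> 0 \<longrightarrow>
          (\<exists>v. v \<noteq> 0 \<and> supp v \<subseteq> supp u \<and> 0 \<le> u * v \<and> u \<bullet> v = N u * dual_norm N v)))
   \<and> (orthant_monotonic N \<longleftrightarrow>
        (\<forall>x J K. J \<subseteq> K \<longrightarrow> N (coord_proj J x) \<le> N (coord_proj K x)))
   \<and> (orthant_monotonic N \<longleftrightarrow>
        (\<forall>K. coord_proj K ` unit_ball N = coord_subspace K \<inter> unit_ball N))"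
proof (intro conjI)
  note contractive = orthant_monotonic_iff_coord_proj_contractive[OF assms]
  show "orthant_monotonic N \<longleftrightarrow> orthant_monotonic (dual_norm N)"
    by (simp add: orthant_monotonic_dual_norm_iff assms)
  show "orthant_monotonic N \<longleftrightarrow>
      (\<forall>K. \<forall>y\<in>coord_subspace K. dual_norm_on (coord_subspace K) N y = dual_norm N y)"
    by (simp add: contractive dual_norm_on_coord_subspace_iff[OF assms])
  show "orthant_monotonic N \<longleftrightarrow>
      (\<forall>K. birkhoff_orthogonal N (coord_subspace K) (coord_subspace (- K)))"
    by (simp only: contractive birkhoff_orthogonal_coord_iff)
  show "orthant_monotonic N \<longleftrightarrow>
      (\<forall>K. card K = CARD('d) - 1 \<longrightarrow>
        birkhoff_orthogonal N (coord_subspace K) (coord_subspace (- K)))"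
    unfolding birkhoff_orthogonal_coord_iff card_eq_CARD_minus_1_iff
    using contractive orthant_monotonicI[OF assms] by blast
  show "orthant_monotonic N \<longleftrightarrow>
      (\<forall>u. u \<noteq> 0 \<longrightarrow>
        (\<exists>v. v \<noteq> 0 \<and> supp v \<subseteq> supp u \<and> 0 \<le> u * v \<and> u \<bullet> v = N u * dual_norm N v))"
    using orthant_monotonic_dual_vector[OF assms] coord_proj_contractive_if_dual_vector[OF assms]
    unfolding contractive by metis
  show "orthant_monotonic N \<longleftrightarrow>
      (\<forall>x J K. J \<subseteq> K \<longrightarrow> N (coord_proj J x) \<le> N (coord_proj K x))"
    using orthant_monotonic_coord_proj_mono contractive coord_proj_UNIV subset_UNIV by metis
  show "orthant_monotonic N \<longleftrightarrow>
      (\<forall>K. coord_proj K ` unit_ball N = coord_subspace K \<inter> unit_ball N)"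
    by (simp add: contractive coord_proj_unit_ball_iff[OF assms])
qed

end
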